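(* Let $G$ be a finite abelian group, let $A\subset G\setminus\{0\}$ and let $k\ge 9$ be an integer. Suppose that $A\cap(-A)=\emptyset$, that $\Sigma(A)$ has trivial stabiliser, and that $|A|\ge n_{k}$. Then $|\Sigma(A)|\ge \alpha_{k}|A|^{2}$.
   Context: For a subset $A$ of a finite abelian group $G$, $\Sigma(A)=\{\sum_{a\in B}a:\,B\subset A\}$ is the set of all subset sums of $A$ (the empty sum being $0$), and $-A=\{-a:a\in A\}$. For $S\subset G$ the stabiliser is $\mathrm{Stab}(S)=\{g\in G: S+g=S\}$; $S$ has trivial stabiliser if $\mathrm{Stab}(S)=\{0\}$. The sequences $(n_k)_{k\ge 9}$ and $(\alpha_k)_{k\ge 9}$ are defined by $n_9=1$ and $n_k=2^{k^2}$ for $k\ge 10$; $\alpha_9=1/64$ and $\alpha_k=\min\{\frac65\alpha_{k-1},\ \frac12-\frac{1}{2^{k-1}}\}$ for $k\ge 10$. *)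

theory Defs
  imports Complex_Main
begin

text \<open>
  A finite abelian group is a type of class ab_group_add and finite, written
  additively; the group is the whole type.
\<close>

definition subset_sums :: "'a::comm_monoid_add set \<Rightarrow> 'a set" where
  "subset_sums A = {\<Sum>a\<in>B. a |B. B \<subseteq> A}"

definition stab :: "'a::ab_group_add set \<Rightarrow> 'a set" where
  "stab S = {g. (\<lambda>s. s + g) ` S = S}"

text \<open>
  The two sequences are indexed by integers at least 9; the values given to smaller indices
  are irrelevant.
\<close>

definition n_seq :: "nat \<Rightarrow> nat" where
  "n_seq k = (if k \<le> 9 then 1 else 2 ^ (k ^ 2))"

fun alpha_seq :: "nat \<Rightarrow> real" where
  "alpha_seq k =
    (if k \<le> 9 then 1 / 64
     else min (6 / 5 * alpha_seq (k - 1)) (1 / 2 - 1 / 2 ^ (k - 1)))"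

declare alpha_seq.simps [simp del]

end

theory Submission
  imports Defs "HOL-Library.Set_Algebras"
begin

text \<open>
  Aperiodicity of \<open>subset_sums A\<close> passes to all subsets of \<open>A\<close>, so the theorem can be proved by
  removing elements of \<open>A\<close> one at a time. Let \<open>B = subset_sums A\<close>, let \<open>G\<close> be the group spanned
  by \<open>A\<close>, and let \<open>d\<close> be the smaller of the sizes of \<open>B\<close> and of its complement in \<open>G\<close>. Hamidoune's
  atoms show that adding the symmetric set \<open>S = {0} \<union> A \<union> -A\<close> enlarges every subset of \<open>G\<close> by at
  least \<open>g = |K + S| - |K|\<close> for a proper subgroup \<open>K\<close>. Following Olson, one averages
  \<open>|(B + x) - B|\<close> over the elements \<open>x\<close> of small iterated sumsets of \<open>S\<close>; this yields some \<open>a\<close> in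
  \<open>A\<close> whose removal loses at least \<open>g d / (2 (d + g))\<close> subset sums. Since \<open>A \<inter> K\<close> is aperiodic as
  well, it has at most \<open>8 |K|^(1/2)\<close> elements, which makes \<open>g\<close> almost \<open>2 |A|\<close>. Thus the loss is
  almost \<open>|A|\<close> at each step, except while the complement of \<open>B\<close> is small; but then the complement
  grows geometrically, and only few steps are wasted.
\<close>

subsection \<open>Atoms\<close>

definition add_subgroup :: "'a::ab_group_add set \<Rightarrow> bool" where
  "add_subgroup H \<longleftrightarrow> 0 \<in> H \<and> (\<forall>x\<in>H. \<forall>y\<in>H. x - y \<in> H)"

lemma add_subgroup_zero: "add_subgroup H \<Longrightarrow> 0 \<in> H"
  by (simp add: add_subgroup_def)

lemma add_subgroup_diff: "add_subgroup H \<Longrightarrow> x \<in> H \<Longrightarrow> y \<in> H \<Longrightarrow> x - y \<in> H"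
  by (simp add: add_subgroup_def)

lemma add_subgroup_uminus: "add_subgroup H \<Longrightarrow> x \<in> H \<Longrightarrow> - x \<in> H"
  using add_subgroup_diff[of H 0 x] by (simp add: add_subgroup_zero)

lemma add_subgroup_add: "add_subgroup H \<Longrightarrow> x \<in> H \<Longrightarrow> y \<in> H \<Longrightarrow> x + y \<in> H"
  using add_subgroup_diff[of H x "- y"] by (simp add: add_subgroup_uminus)

lemma add_subgroup_sum: "add_subgroup H \<Longrightarrow> (\<And>x. x \<in> B \<Longrightarrow> f x \<in> H) \<Longrightarrow> sum f B \<in> H"
  by (induction B rule: infinite_finite_induct) (auto simp: add_subgroup_zero add_subgroup_add)

definition span_of :: "'a::ab_group_add set \<Rightarrow> 'a set" where
  "span_of A = \<Inter>{H. add_subgroup H \<and> A \<subseteq> H}"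

lemma add_subgroup_span_of: "add_subgroup (span_of A)"
  by (auto simp: span_of_def add_subgroup_def)

lemma span_of_superset: "A \<subseteq> span_of A"
  by (auto simp: span_of_def)

lemma span_of_least: "add_subgroup H \<Longrightarrow> A \<subseteq> H \<Longrightarrow> span_of A \<subseteq> H"
  by (auto simp: span_of_def)

lemma set_plus_superset:
  fixes X :: "'a::ab_group_add set"
  assumes "0 \<in> S"
  shows "X \<subseteq> X + S"
proof
  fix x assume "x \<in> X"
  then have "x + 0 \<in> X + S" using assms by (intro set_plus_intro)
  then show "x \<in> X + S" by simp
qed

lemma set_plus_subgroup_subset:
  "add_subgroup G \<Longrightarrow> X \<subseteq> G \<Longrightarrow> S \<subseteq> G \<Longrightarrow> X + S \<subseteq> G"
  by (auto elim!: set_plus_elim intro!: add_subgroup_add)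

lemma set_plus_translate:
  fixes X :: "'a::ab_group_add set"
  shows "(\<lambda>x. x - u) ` X + S = (\<lambda>x. x - u) ` (X + S)"
proof (intro equalityI subsetI)
  fix z assume "z \<in> (\<lambda>x. x - u) ` X + S"
  then obtain x s where "x \<in> X" "s \<in> S" "z = x - u + s" by (auto elim!: set_plus_elim)
  then show "z \<in> (\<lambda>x. x - u) ` (X + S)"
    by (intro image_eqI[where x = "x + s"]) (auto simp: algebra_simps)
next
  fix z assume "z \<in> (\<lambda>x. x - u) ` (X + S)"
  then obtain x s where "x \<in> X" "s \<in> S" "z = (x - u) + s"
    by (auto elim!: set_plus_elim simp: algebra_simps)
  then show "z \<in> (\<lambda>x. x - u) ` X + S" by (auto intro!: set_plus_intro)
qed

lemma card_translate:
  fixes X :: "'a::ab_group_add set"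
  shows "card ((\<lambda>x. x - u) ` X) = card X"
  by (intro card_image) (auto simp: inj_on_def)

text \<open>Among the nonempty \<open>X\<close> in \<open>G\<close> whose sumset with
  \<open>S\<close> is not all of \<open>G\<close>, take those of least growth
  \<open>|X + S| - |X|\<close>, and among these one of least size: an atom. Atoms that meet
  coincide, so the translate of an atom that contains \<open>0\<close> is a subgroup
  \<open>K\<close>. The \<open>min\<close> with \<open>card G\<close> covers the sets with
  \<open>X + S = G\<close>.\<close>

lemma subgroup_isoperimetry:
  fixes G S :: "'a::{ab_group_add, finite} set"
  assumes G: "add_subgroup G" and SG: "S \<subseteq> G" and S0: "0 \<in> S"
    and sym: "\<And>s. s \<in> S \<Longrightarrow> - s \<in> S" and nontriv: "G \<noteq> {0}"
  obtains K where "add_subgroup K" "K \<subseteq> G" "K \<noteq> G"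
    "\<And>X. X \<subseteq> G \<Longrightarrow> X \<noteq> {} \<Longrightarrow>
      min (card G) (card X + (card (K + S) - card K)) \<le> card (X + S)"
proof (cases "S = G")
  case True
  have "X + S = G" if "X \<subseteq> G" "X \<noteq> {}" for X
  proof
    show "X + S \<subseteq> G" using set_plus_subgroup_subset[OF G that(1)] SG .
    show "G \<subseteq> X + S"
    proof
      fix z assume z: "z \<in> G"
      obtain x where x: "x \<in> X" using \<open>X \<noteq> {}\<close> by blast
      then have "x + (z - x) \<in> X + S"
        using z x \<open>X \<subseteq> G\<close> True add_subgroup_diff[OF G] by (intro set_plus_intro) auto
      then show "z \<in> X + S" by simp
    qed
  qed
  then show ?thesis
    using nontriv add_subgroup_zero[OF G] by (intro that[of "{0}"]) (auto simp: add_subgroup_def)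
next
  case False
  define F where "F = {X. X \<noteq> {} \<and> X \<subseteq> G \<and> X + S \<noteq> G}"
  define \<delta> where "\<delta> X = card (X + S) - card X" for X
  have card_plus: "card (X + S) = card X + \<delta> X" for X
    unfolding \<delta>_def using card_mono[OF _ set_plus_superset[OF S0, of X]] by simp
  have "{0} \<in> F" using False add_subgroup_zero[OF G] by (auto simp: F_def)
  then obtain X0 where X0: "X0 \<in> F" "\<And>X. X \<in> F \<Longrightarrow> \<delta> X0 \<le> \<delta> X"
    using ex_has_least_nat[of "\<lambda>X. X \<in> F" "{0}" \<delta>] by auto
  define \<kappa> where "\<kappa> = \<delta> X0"
  have \<kappa>_le: "\<kappa> \<le> \<delta> X" if "X \<in> F" for X using X0 that by (simp add: \<kappa>_def)
  obtain U where U: "U \<in> F" "\<delta> U = \<kappa>"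
    and U_min: "\<And>X. X \<in> F \<Longrightarrow> \<delta> X = \<kappa> \<Longrightarrow> card U \<le> card X"
    using ex_has_least_nat[of "\<lambda>X. X \<in> F \<and> \<delta> X = \<kappa>" X0 card] X0 by (auto simp: \<kappa>_def)
  have plus_sub: "X + S \<subseteq> G" if "X \<in> F" for X
    using set_plus_subgroup_subset[OF G _ SG] that by (simp add: F_def)
  \<comment> \<open>Since \<open>S\<close> is symmetric, the complement \<open>V\<close> of
    \<open>U + S\<close> has a sumset that misses \<open>U\<close>. So \<open>V\<close> is a
    candidate with growth at most \<open>\<kappa>\<close>, and \<open>U\<close> is no larger than
    \<open>V\<close>.\<close>
  have card_U_bound: "2 * card U + \<kappa> \<le> card G"
  proof -
    define V where "V = G - (U + S)"
    have disj: "(V + S) \<inter> U = {}"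
    proof (rule ccontr)
      assume "(V + S) \<inter> U \<noteq> {}"
      then obtain v s where "v \<in> V" "s \<in> S" "v + s \<in> U" by (auto elim!: set_plus_elim)
      then have "(v + s) + (- s) \<in> U + S" using sym by (intro set_plus_intro)
      with \<open>v \<in> V\<close> show False by (simp add: V_def)
    qed
    have "V \<noteq> {}" using U plus_sub[OF U(1)] by (auto simp: V_def F_def)
    have VG: "V \<subseteq> G" by (auto simp: V_def)
    have UG: "U \<subseteq> G" "U \<noteq> {}" using U by (auto simp: F_def)
    have VS: "V + S \<subseteq> G - U"
      using disj set_plus_subgroup_subset[OF G VG SG] by blast
    have VF: "V \<in> F" using VG \<open>V \<noteq> {}\<close> VS UG by (auto simp: F_def)
    have cV: "card V + card U + \<kappa> = card G"
      using card_Diff_subset[of "U + S" G] plus_sub[OF U(1)] card_plus[of U] U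
        card_mono[OF _ plus_sub[OF U(1)]] by (simp add: V_def)
    have "card (V + S) + card U \<le> card G"
      using card_mono[OF _ VS] card_Diff_subset[of U G] UG card_mono[OF _ UG(1)] by simp
    then have "\<delta> V \<le> \<kappa>" using card_plus[of V] cV by simp
    then have "card U \<le> card V" using U_min VF \<kappa>_le[OF VF] by simp
    with cV show ?thesis by simp
  qed
  \<comment> \<open>Submodularity: the growths of \<open>P \<inter> Q\<close> and
    \<open>P \<union> Q\<close> add up to at most \<open>2 * \<kappa>\<close>. If both sets are
    candidates, the intersection attains the minimum and cannot be smaller than an atom.\<close>
  have atoms: "P = Q"
    if P: "P \<in> F" "\<delta> P = \<kappa>" "card P = card U" and Q: "Q \<in> F" "\<delta> Q = \<kappa>" "card Q = card U"
      and PQ: "P \<inter> Q \<noteq> {}" for P Q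
  proof -
    have I: "(P \<inter> Q) + S \<subseteq> (P + S) \<inter> (Q + S)" by (auto elim!: set_plus_elim intro: set_plus_intro)
    have Un: "(P \<union> Q) + S = (P + S) \<union> (Q + S)" by (auto elim!: set_plus_elim intro: set_plus_intro)
    have IF: "P \<inter> Q \<in> F" using P PQ I plus_sub[OF P(1)] by (auto simp: F_def)
    have e1: "card ((P + S) \<union> (Q + S)) + card ((P + S) \<inter> (Q + S)) = 2 * card U + 2 * \<kappa>"
      using card_Un_Int[of "P + S" "Q + S"] card_plus P Q by simp
    have e2: "card ((P \<inter> Q) + S) \<le> card ((P + S) \<inter> (Q + S))" using I by (intro card_mono) auto
    have e3: "card (P \<union> Q) + card (P \<inter> Q) = 2 * card U"
      using card_Un_Int[of P Q] P Q by simp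
    have cI: "card (P \<inter> Q) > 0" using PQ by (simp add: card_gt_0_iff)
    \<comment> \<open>Otherwise \<open>e1\<close>, \<open>e2\<close> and \<open>card_U_bound\<close>
      would leave at most \<open>\<kappa>\<close> elements for \<open>(P \<inter> Q) + S\<close>,
      but the nonempty set \<open>P \<inter> Q\<close> grows by at least
      \<open>\<kappa>\<close>.\<close>
    have "(P \<union> Q) + S \<noteq> G"
    proof
      assume "(P \<union> Q) + S = G"
      then show False
        using e1 e2 Un card_U_bound card_plus[of "P \<inter> Q"] \<kappa>_le[OF IF] cI by simp
    qed
    then have UF: "P \<union> Q \<in> F" using P Q by (auto simp: F_def)
    have "\<delta> (P \<inter> Q) = \<kappa>"
      using e1 e2 e3 Un card_plus[of "P \<inter> Q"] card_plus[of "P \<union> Q"] \<kappa>_le[OF IF] \<kappa>_le[OF UF]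
      by simp
    then have "card U \<le> card (P \<inter> Q)" using U_min IF by simp
    then have "P \<inter> Q = P" "P \<inter> Q = Q"
      using P Q by (metis card_seteq finite inf_le1, metis card_seteq finite inf_le2)
    then show ?thesis by simp
  qed
  have shift: "(\<lambda>x. x - u) ` U \<in> F" "\<delta> ((\<lambda>x. x - u) ` U) = \<kappa>" if "u \<in> U" for u
  proof -
    have uG: "u \<in> G" using U that by (auto simp: F_def)
    have "(\<lambda>x. x - u) ` (U + S) \<noteq> G"
    proof
      assume "(\<lambda>x. x - u) ` (U + S) = G"
      then have "card (U + S) = card G" using card_translate by metis
      then have "U + S = G" using plus_sub[OF U(1)] by (simp add: card_subset_eq)
      then show False using U by (simp add: F_def)
    qed
    then show "(\<lambda>x. x - u) ` U \<in> F"
      using U uG add_subgroup_diff[OF G] by (auto simp: F_def set_plus_translate)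
    show "\<delta> ((\<lambda>x. x - u) ` U) = \<kappa>"
      using U by (simp add: \<delta>_def set_plus_translate card_translate)
  qed
  obtain u where u: "u \<in> U" using U by (auto simp: F_def)
  define K where "K = (\<lambda>x. x - u) ` U"
  \<comment> \<open>All translates of \<open>U\<close> by minus one of its elements contain
    \<open>0\<close>, hence meet, hence agree. Closure of \<open>K\<close> under differences
    follows.\<close>
  have K_eq: "K = (\<lambda>x. x - v) ` U" if "v \<in> U" for v
    unfolding K_def
    by (rule atoms) (use shift u that in \<open>auto simp: card_translate image_iff disjoint_iff\<close>)
  have K0: "0 \<in> K" using u by (auto simp: K_def)
  have K: "add_subgroup K"
    unfolding add_subgroup_def
  proof (intro conjI ballI)
    fix x y assume "x \<in> K" "y \<in> K"
    then obtain v where v: "v \<in> U" "y = v - u" by (auto simp: K_def)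
    from \<open>x \<in> K\<close> obtain w where w: "w \<in> U" "x = w - u" by (auto simp: K_def)
    have "x - y = w - v" using v w by simp
    moreover have "w - v \<in> K" unfolding K_eq[OF v(1)] using w by blast
    ultimately show "x - y \<in> K" by simp
  qed (use K0 in auto)
  have KF: "K \<in> F" "\<delta> K = \<kappa>" using shift[OF u] by (auto simp: K_def)
  have KG: "K \<subseteq> G" using KF(1) by (simp add: F_def)
  have K_ne: "K \<noteq> G"
  proof
    assume "K = G"
    then have "G \<subseteq> K + S" using set_plus_superset[OF S0] by metis
    with plus_sub[OF KF(1)] KF(1) show False by (auto simp: F_def)
  qed
  have expand: "min (card G) (card X + (card (K + S) - card K)) \<le> card (X + S)"
    if "X \<subseteq> G" "X \<noteq> {}" for X
  proof (cases "X + S = G")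
    case False
    then have "X \<in> F" using that by (simp add: F_def)
    have "card (K + S) - card K = \<kappa>" using KF(2) by (simp add: \<delta>_def)
    then show ?thesis using \<kappa>_le[OF \<open>X \<in> F\<close>] card_plus[of X] by simp
  qed simp
  show ?thesis by (rule that[OF K KG K_ne expand])
qed

subsection \<open>Boundaries\<close>

text \<open>Olson's function: the size of \<open>(B + x) - B\<close>.\<close>

definition boundary :: "'a::ab_group_add set \<Rightarrow> 'a \<Rightarrow> nat" where
  "boundary B x = card {b \<in> B. b + x \<notin> B}"

lemma boundary_zero [simp]: "boundary B 0 = 0"
  by (simp add: boundary_def)

text \<open>An element that leaves \<open>B\<close> under \<open>x + y\<close> leaves it under
  \<open>x\<close>, or else its shift by \<open>x\<close> is an element of \<open>B\<close> that
  leaves under \<open>y\<close>.\<close>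

lemma boundary_add:
  fixes B :: "'a::{ab_group_add, finite} set"
  shows "boundary B (x + y) \<le> boundary B x + boundary B y"
proof -
  have "card {b \<in> B. b + x \<in> B \<and> b + (x + y) \<notin> B} \<le> card {b \<in> B. b + y \<notin> B}"
    by (rule card_inj_on_le[where f = "\<lambda>b. b + x"]) (auto simp: inj_on_def add.assoc)
  moreover have "card {b \<in> B. b + (x + y) \<notin> B} \<le>
      card {b \<in> B. b + x \<notin> B} + card {b \<in> B. b + x \<in> B \<and> b + (x + y) \<notin> B}"
    by (rule order_trans[OF card_mono card_Un_le]) auto
  ultimately show ?thesis by (simp add: boundary_def)
qed

lemma boundary_uminus:
  fixes B :: "'a::{ab_group_add, finite} set"
  shows "boundary B (- x) = boundary B x"
proof -
  have split: "card B = card {b \<in> B. b + y \<in> B} + boundary B y" for y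
    unfolding boundary_def
    by (subst card_Un_disjoint[symmetric]) (auto intro!: arg_cong[where f = card])
  have "bij_betw (\<lambda>b. b - x) {b \<in> B. b + (- x) \<in> B} {b \<in> B. b + x \<in> B}"
    by (rule bij_betw_byWitness[where f' = "\<lambda>b. b + x"]) auto
  then show ?thesis using split[of x] split[of "- x"] bij_betw_same_card by fastforce
qed

text \<open>A shift by \<open>x\<close> carries the elements that leave \<open>G - B\<close> onto
  the elements of \<open>B\<close> that leave \<open>B\<close> under \<open>- x\<close>.\<close>

lemma boundary_complement:
  fixes B :: "'a::{ab_group_add, finite} set"
  assumes G: "add_subgroup G" and "B \<subseteq> G" "x \<in> G"
  shows "boundary (G - B) x = boundary B x"
proof -
  have "bij_betw (\<lambda>b. b + x) {b \<in> G - B. b + x \<notin> G - B} {b \<in> B. b + (- x) \<notin> B}"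
    by (rule bij_betw_byWitness[where f' = "\<lambda>b. b - x"])
      (use assms add_subgroup_add[OF G] add_subgroup_diff[OF G] in auto)
  then show ?thesis using boundary_uminus[of B x] bij_betw_same_card
    by (fastforce simp: boundary_def)
qed

text \<open>Double counting: a pair \<open>(x, b)\<close> with \<open>b\<close> and
  \<open>b + x\<close> both in \<open>D\<close> is determined by these two elements, so there are at
  most \<open>card D * card D\<close> such pairs.\<close>

lemma sum_boundary_ge:
  fixes D :: "'a::{ab_group_add, finite} set"
  shows "card C * card D \<le> (\<Sum>x\<in>C. boundary D x) + card D * card D"
proof -
  have split: "card D = card {b \<in> D. b + y \<in> D} + boundary D y" for y
    unfolding boundary_def
    by (subst card_Un_disjoint[symmetric]) (auto intro!: arg_cong[where f = card])
  have "(\<Sum>x\<in>C. card {b \<in> D. b + x \<in> D}) = card (SIGMA x:C. {b \<in> D. b + x \<in> D})"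
    by (simp add: card_SigmaI)
  also have "\<dots> \<le> card (D \<times> D)"
    by (rule card_inj_on_le[where f = "\<lambda>(x, b). (b, b + x)"]) (auto simp: inj_on_def)
  finally have "(\<Sum>x\<in>C. card {b \<in> D. b + x \<in> D}) \<le> card D * card D"
    by (simp add: card_cartesian_product)
  moreover have "card C * card D = (\<Sum>x\<in>C. card {b \<in> D. b + x \<in> D} + boundary D x)"
    by (simp flip: split)
  ultimately show ?thesis by (simp add: sum.distrib)
qed

text \<open>
  Elements of the \<open>j\<close>-fold sumset of \<open>S\<close> have boundary at most \<open>j * m\<close>, and that sumset has
  at least \<open>1 + j * g\<close> elements, so a set \<open>C\<close> of elements with small boundary can be
  collected greedily.
\<close>

lemma small_boundary_set:
  fixes G S :: "'a::{ab_group_add, finite} set"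
  assumes G: "add_subgroup G" and SG: "S \<subseteq> G" and g: "g > 0"
    and expand: "\<And>X. X \<subseteq> G \<Longrightarrow> X \<noteq> {} \<Longrightarrow> min (card G) (card X + g) \<le> card (X + S)"
    and m: "\<And>s. s \<in> S \<Longrightarrow> boundary D s \<le> m"
    and "N \<le> card G"
  shows "\<exists>C \<subseteq> G. card C = N \<and>
    (\<Sum>x\<in>C. real (boundary D x)) \<le> m * (real N ^ 2 / (2 * g) + N)"
proof -
  define L where "L j = ((\<lambda>X. X + S) ^^ j) {0}" for j
  have L_0: "L 0 = {0}" and L_Suc: "L (Suc j) = L j + S" for j by (simp_all add: L_def)
  have L_sub: "L j \<subseteq> G" for j
    by (induction j) (use add_subgroup_zero[OF G] set_plus_subgroup_subset[OF G _ SG] in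
        \<open>auto simp: L_0 L_Suc\<close>)
  have card_L: "min (card G) (1 + j * g) \<le> card (L j)" for j
  proof (induction j)
    case 0
    then show ?case by (simp add: L_0)
  next
    case (Suc j)
    have "card G > 0" using add_subgroup_zero[OF G] by (auto simp: card_gt_0_iff)
    then have "L j \<noteq> {}" using Suc by auto
    from expand[OF L_sub this] Suc show ?case by (simp add: L_Suc)
  qed
  have bd: "boundary D x \<le> j * m" if "x \<in> L j" for x j
    using that
  proof (induction j arbitrary: x)
    case 0
    then show ?case by (simp add: L_0)
  next
    case (Suc j)
    then obtain y s where "y \<in> L j" "s \<in> S" "x = y + s" by (auto simp: L_Suc elim!: set_plus_elim)
    then show ?case using Suc.IH[of y] m[of s] boundary_add[of D y s] by simp
  qed
  show ?thesis
    using \<open>N \<le> card G\<close>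
  proof (induction N)
    case 0
    then show ?case by (intro exI[of _ "{}"]) simp
  next
    case (Suc N)
    then obtain C where C: "C \<subseteq> G" "card C = N"
      "(\<Sum>x\<in>C. real (boundary D x)) \<le> m * (real N ^ 2 / (2 * g) + N)" by auto
    \<comment> \<open>The least number of summands with \<open>N \<le> j * g\<close>. Then
      \<open>L j\<close> has more than \<open>N\<close> elements, so one of them is still outside
      \<open>C\<close>.\<close>
    define j where "j = nat \<lceil>real N / g\<rceil>"
    have j: "real N / g \<le> j" "j \<le> real N / g + 1"
      unfolding j_def by (simp_all add: ceiling_correct)
    have "real N \<le> real j * real g" using j(1) g by (simp add: field_simps)
    then have "N \<le> j * g" by (metis of_nat_le_iff of_nat_mult)
    then have "N < card (L j)" using card_L[of j] Suc.prems by simp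
    then have "\<not> L j \<subseteq> C" using C(2) card_mono[of C "L j"] by auto
    then obtain x where x: "x \<in> L j" "x \<notin> C" by blast
    have "real (boundary D x) \<le> real (j * m)" using bd[OF x(1)] by (simp only: of_nat_le_iff)
    also have "\<dots> \<le> m * (real N / g + 1)" using mult_left_mono[OF j(2), of "real m"] by (simp add: mult.commute)
    finally have bx: "real (boundary D x) \<le> m * (real N / g + 1)" .
    have "(\<Sum>y\<in>insert x C. real (boundary D y)) \<le>
        m * (real N ^ 2 / (2 * g) + N) + m * (real N / g + 1)"
      using C(3) bx x(2) by simp
    also have "\<dots> = m * (real N ^ 2 / (2 * g) + N + (real N / g + 1))"
      by (simp add: algebra_simps)
    \<comment> \<open>The quadratic term increases by \<open>(2 * N + 1) / (2 * g)\<close>, which is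
      at least \<open>N / g\<close>, and the linear term by \<open>1\<close>.\<close>
    also have "\<dots> \<le> m * (real (Suc N) ^ 2 / (2 * g) + Suc N)"
      using g by (intro mult_left_mono) (auto simp: field_simps power2_eq_square)
    finally show ?case
      using C x L_sub by (intro exI[of _ "insert x C"]) auto
  qed
qed

text \<open>Average over a set \<open>C\<close> of \<open>2 * d\<close> elements: the boundaries sum
  to at least \<open>2 * d * d - d * d\<close>, and by the greedy choice to at most
  \<open>m * (2 * d * d / g + 2 * d)\<close>.\<close>

lemma large_boundary:
  fixes G S :: "'a::{ab_group_add, finite} set"
  assumes G: "add_subgroup G" and SG: "S \<subseteq> G" and g: "g > 0"
    and expand: "\<And>X. X \<subseteq> G \<Longrightarrow> X \<noteq> {} \<Longrightarrow> min (card G) (card X + g) \<le> card (X + S)"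
    and m: "\<And>s. s \<in> S \<Longrightarrow> boundary B s \<le> m"
    and B: "B \<subseteq> G" "B \<noteq> {}" "B \<noteq> G"
  defines "d \<equiv> min (card B) (card G - card B)"
  shows "g * d \<le> 2 * m * (d + g)"
proof -
  have card_GB: "card (G - B) = card G - card B" using B by (simp add: card_Diff_subset)
  \<comment> \<open>A set and its complement have equal boundaries, so \<open>D\<close> can be the
    smaller of the two. This gives \<open>2 * d \<le> card G\<close>, which leaves room for
    \<open>C\<close>.\<close>
  obtain D where D: "card D = d" "\<And>s. s \<in> S \<Longrightarrow> boundary D s \<le> m"
  proof (cases "card B \<le> card G - card B")
    case True
    then show ?thesis using that[of B] m by (simp add: d_def)
  next
    case False
    then show ?thesis using that[of "G - B"] m card_GB boundary_complement[OF G B(1)] SG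
      by (auto simp: d_def subset_iff)
  qed
  have d: "2 * d \<le> card G" using card_mono[of G B] B by (simp add: d_def)
  obtain C where C: "card C = 2 * d"
    "(\<Sum>x\<in>C. real (boundary D x)) \<le> m * (real (2 * d) ^ 2 / (2 * g) + (2 * d))"
    using small_boundary_set[OF G SG g expand D(2) d] by (auto simp: subset_iff)
  have "real (card C * card D) \<le> real ((\<Sum>x\<in>C. boundary D x) + card D * card D)"
    using sum_boundary_ge[of C D] by (simp only: of_nat_le_iff)
  then have "real d * d \<le> m * (real (2 * d) ^ 2 / (2 * g) + (2 * d))"
    using C D(1) by simp
  also have "\<dots> = (2 * real d / g) * (m * (d + g))"
    using g by (simp add: field_simps power2_eq_square)
  finally have "real d * (g * d) \<le> real d * (2 * m * (d + g))"
    using g by (simp add: field_simps)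
  then have "real d * real (g * d) \<le> real d * real (2 * m * (d + g))" by simp
  moreover have "card B < card G" using B by (intro psubset_card_mono) auto
  then have "d > 0" using B by (auto simp: d_def card_gt_0_iff)
  ultimately show ?thesis
    by (metis mult_le_cancel_left_pos of_nat_0_less_iff of_nat_le_iff)
qed

subsection \<open>Removing an element\<close>

lemma subset_sums_insert:
  fixes A :: "'a::{ab_group_add, finite} set"
  assumes "a \<notin> A"
  shows "subset_sums (insert a A) = subset_sums A \<union> (\<lambda>s. s + a) ` subset_sums A"
proof (intro equalityI subsetI)
  fix s assume "s \<in> subset_sums (insert a A)"
  then obtain B where B: "B \<subseteq> insert a A" "s = \<Sum>B" by (auto simp: subset_sums_def)
  show "s \<in> subset_sums A \<union> (\<lambda>s. s + a) ` subset_sums A"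
  proof (cases "a \<in> B")
    case True
    then have "s = \<Sum>(B - {a}) + a" using B by (simp add: sum.remove add.commute)
    moreover have "B - {a} \<subseteq> A" using B by auto
    ultimately show ?thesis by (auto simp: subset_sums_def)
  next
    case False
    then have "B \<subseteq> A" using B by auto
    then show ?thesis using B by (auto simp: subset_sums_def)
  qed
next
  fix s assume "s \<in> subset_sums A \<union> (\<lambda>s. s + a) ` subset_sums A"
  then obtain B where B: "B \<subseteq> A" "s = \<Sum>B \<or> s = \<Sum>B + a" by (auto simp: subset_sums_def)
  have "\<Sum>(insert a B) = \<Sum>B + a" using B assms by (subst sum.insert) (auto simp: add.commute)
  then have "s = \<Sum>B \<or> s = \<Sum>(insert a B)" using B by simp
  moreover have "B \<subseteq> insert a A" "insert a B \<subseteq> insert a A" using B by auto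
  ultimately show "s \<in> subset_sums (insert a A)" unfolding subset_sums_def by blast
qed

lemma subset_sums_remove:
  fixes A :: "'a::{ab_group_add, finite} set"
  assumes "a \<in> A"
  shows "subset_sums A = subset_sums (A - {a}) \<union> (\<lambda>s. s + a) ` subset_sums (A - {a})"
  using subset_sums_insert[of a "A - {a}"] assms by (simp add: insert_absorb)

lemma zero_in_subset_sums: "0 \<in> subset_sums A"
  by (auto simp: subset_sums_def intro!: exI[of _ "{}"])

lemma subset_sums_subset: "add_subgroup H \<Longrightarrow> A \<subseteq> H \<Longrightarrow> subset_sums A \<subseteq> H"
  by (auto simp: subset_sums_def intro!: add_subgroup_sum)

text \<open>Adjoining \<open>a\<close> replaces \<open>T\<close> by the union of \<open>T\<close>
  and \<open>T + a\<close>, and every period of \<open>T\<close> is a period of that union.\<close>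

lemma stab_subset_sums_Un:
  fixes A :: "'a::{ab_group_add, finite} set"
  shows "stab (subset_sums A) \<subseteq> stab (subset_sums (A \<union> F))"
proof (induction F rule: infinite_finite_induct)
  case (insert a F)
  show ?case
  proof (cases "a \<in> A")
    case False
    then have "a \<notin> A \<union> F" using insert by auto
    then have eq: "subset_sums (A \<union> insert a F) =
        subset_sums (A \<union> F) \<union> (\<lambda>s. s + a) ` subset_sums (A \<union> F)"
      by (simp add: subset_sums_insert)
    have mono: "stab T \<subseteq> stab (T \<union> (\<lambda>s. s + a) ` T)" for T :: "'a set"
    proof
      fix g assume "g \<in> stab T"
      then have T: "(\<lambda>s. s + g) ` T = T" by (simp add: stab_def)
      have "(\<lambda>s. s + g) ` (\<lambda>s. s + a) ` T = (\<lambda>s. s + a) ` (\<lambda>s. s + g) ` T"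
        unfolding image_image by (simp add: ac_simps)
      then show "g \<in> stab (T \<union> (\<lambda>s. s + a) ` T)" using T by (simp add: stab_def image_Un)
    qed
    show ?thesis unfolding eq by (rule subset_trans[OF insert.IH mono])
  qed (use insert in \<open>simp add: insert_absorb\<close>)
qed auto

text \<open>The hypotheses in a form that passes to subsets. Inclusion amounts to equality, because
  \<open>0\<close> always lies in the stabiliser.\<close>

definition admissible :: "'a::ab_group_add set \<Rightarrow> bool" where
  "admissible A \<longleftrightarrow> A \<inter> uminus ` A = {} \<and> stab (subset_sums A) \<subseteq> {0}"

lemma admissible_subset:
  fixes A :: "'a::{ab_group_add, finite} set"
  assumes "admissible A" "A' \<subseteq> A"
  shows "admissible A'"
proof -
  have "stab (subset_sums A') \<subseteq> stab (subset_sums A)"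
    using stab_subset_sums_Un[of A' A] assms by (simp add: Un_absorb1)
  moreover have "A' \<inter> uminus ` A' \<subseteq> A \<inter> uminus ` A" using assms by blast
  ultimately show ?thesis using assms(1) unfolding admissible_def by blast
qed

lemma admissible_zero: "admissible A \<Longrightarrow> 0 \<notin> A"
  unfolding admissible_def by (metis disjoint_iff image_eqI minus_zero)

lemma card_symmetrize:
  fixes A :: "'a::{ab_group_add, finite} set"
  assumes "admissible A" "X \<subseteq> A"
  shows "card (X \<union> uminus ` X) = 2 * card X"
proof -
  have "X \<inter> uminus ` X = {}" using assms by (auto simp: admissible_def)
  then show ?thesis by (simp add: card_Un_disjoint card_image)
qed

lemma card_subset_sums_ge:
  fixes A :: "'a::{ab_group_add, finite} set"
  assumes "admissible A"
  shows "card A + 1 \<le> card (subset_sums A)"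
proof -
  have "a \<in> subset_sums A" if "a \<in> A" for a
    using that by (auto simp: subset_sums_def intro!: exI[of _ "{a}"])
  then have "card (insert 0 A) \<le> card (subset_sums A)"
    using zero_in_subset_sums[of A] by (intro card_mono) auto
  then show ?thesis using admissible_zero[OF assms] by simp
qed

text \<open>Measured inside the span of \<open>A\<close>, which may shrink as elements are removed.
  The subtraction is exact by \<open>subset_sums_le_span\<close>.\<close>

definition defect :: "'a::ab_group_add set \<Rightarrow> nat" where
  "defect A = card (span_of A) - card (subset_sums A)"

lemma subset_sums_le_span:
  fixes A :: "'a::{ab_group_add, finite} set"
  shows "subset_sums A \<subseteq> span_of A" "card (subset_sums A) + defect A = card (span_of A)"
proof -
  show *: "subset_sums A \<subseteq> span_of A"
    by (rule subset_sums_subset[OF add_subgroup_span_of span_of_superset])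
  show "card (subset_sums A) + defect A = card (span_of A)"
    using card_mono[OF _ *] by (simp add: defect_def)
qed

text \<open>A subgroup is invariant under translation by its elements, so equality would make each
  element of \<open>A\<close> a nonzero period.\<close>

lemma subset_sums_ne_span:
  fixes A :: "'a::{ab_group_add, finite} set"
  assumes "admissible A" "A \<noteq> {}"
  shows "subset_sums A \<noteq> span_of A"
proof
  assume eq: "subset_sums A = span_of A"
  obtain a where a: "a \<in> A" using assms by blast
  have H: "add_subgroup (span_of A)" and aH: "a \<in> span_of A"
    using add_subgroup_span_of span_of_superset a by auto
  have "(\<lambda>s. s + a) ` span_of A = span_of A"
  proof (intro equalityI subsetI)
    fix x assume "x \<in> span_of A"
    then show "x \<in> (\<lambda>s. s + a) ` span_of A"
      using add_subgroup_diff[OF H _ aH] by (intro image_eqI[where x = "x - a"]) auto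
  qed (use add_subgroup_add[OF H _ aH] in auto)
  then have "a \<in> stab (subset_sums A)" by (simp add: stab_def eq)
  then show False using assms a admissible_zero[OF assms(1)] by (auto simp: admissible_def)
qed

lemma defect_pos:
  fixes A :: "'a::{ab_group_add, finite} set"
  assumes "admissible A" "A \<noteq> {}"
  shows "defect A > 0"
  using psubset_card_mono[of "span_of A" "subset_sums A"] subset_sums_le_span(1)
    subset_sums_ne_span[OF assms] by (auto simp: defect_def)

text \<open>A sum \<open>b\<close> for which \<open>b + a\<close> is not a subset sum cannot be a
  sum over \<open>A - {a}\<close>, so it is lost together with \<open>a\<close>.\<close>

lemma boundary_le_growth:
  fixes A :: "'a::{ab_group_add, finite} set"
  assumes "a \<in> A"
  shows "card (subset_sums (A - {a})) + boundary (subset_sums A) a \<le> card (subset_sums A)"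
proof -
  define T where "T = subset_sums (A - {a})"
  have B: "subset_sums A = T \<union> (\<lambda>s. s + a) ` T"
    using subset_sums_remove[OF assms] by (simp add: T_def)
  have "card {b \<in> subset_sums A. b + a \<notin> subset_sums A} \<le> card (subset_sums A - T)"
    unfolding B by (intro card_mono) auto
  moreover have "card (subset_sums A - T) + card T = card (subset_sums A)"
    using card_Diff_subset[of T "subset_sums A"] card_mono[of "subset_sums A" T] by (simp add: B)
  ultimately show ?thesis by (simp add: boundary_def T_def)
qed

text \<open>If the span shrinks, \<open>a\<close> lies outside the span of the rest, and the sums
  with and without \<open>a\<close> lie in different cosets of it.\<close>

lemma card_subset_sums_doubles:
  fixes A :: "'a::{ab_group_add, finite} set"
  assumes "a \<in> A" "span_of (A - {a}) \<noteq> span_of A"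
  shows "card (subset_sums A) = 2 * card (subset_sums (A - {a}))"
proof -
  define H where "H = span_of (A - {a})"
  have H: "add_subgroup H" by (simp add: H_def add_subgroup_span_of)
  have "a \<notin> H"
  proof
    assume "a \<in> H"
    then have "A \<subseteq> H" using span_of_superset[of "A - {a}"] by (auto simp: H_def)
    then have "span_of A \<subseteq> H" by (rule span_of_least[OF H])
    moreover have "H \<subseteq> span_of A"
      unfolding H_def
      by (rule span_of_least[OF add_subgroup_span_of]) (use span_of_superset in auto)
    ultimately show False using assms by (simp add: H_def)
  qed
  have sub: "subset_sums (A - {a}) \<subseteq> H" by (simp add: H_def subset_sums_le_span)
  have "subset_sums (A - {a}) \<inter> (\<lambda>s. s + a) ` subset_sums (A - {a}) = {}"
  proof (rule ccontr)
    assume "\<not> ?thesis"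
    then obtain s where "s \<in> H" "s + a \<in> H" using sub by auto
    then have "(s + a) - s \<in> H" using add_subgroup_diff[OF H] by blast
    then show False using \<open>a \<notin> H\<close> by simp
  qed
  then show ?thesis
    unfolding subset_sums_remove[OF assms(1)]
    by (simp add: card_Un_disjoint card_image inj_on_def)
qed

text \<open>The element \<open>a\<close> has the largest boundary. Both lower bounds on
  \<open>g\<close> come from \<open>K + S - K\<close>: it contains a full coset of \<open>K\<close>,
  and it contains \<open>A - K\<close> together with its negatives. The bound on
  \<open>A \<inter> K\<close> holds because this set and its negative are disjoint inside
  \<open>K\<close>.\<close>

lemma admissible_step:
  fixes A :: "'a::{ab_group_add, finite} set"
  assumes adm: "admissible A" and ne: "A \<noteq> {}"
  defines "d \<equiv> min (card (subset_sums A)) (defect A)"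
  obtains a K g where "a \<in> A" "add_subgroup K" "\<not> A \<subseteq> K"
    "2 * card (A - K) \<le> g" "card K \<le> g" "2 * card (A \<inter> K) \<le> card K"
    "g * d \<le> 2 * (card (subset_sums A) - card (subset_sums (A - {a}))) * (d + g)"
proof -
  define S where "S = insert 0 (A \<union> uminus ` A)"
  define G where "G = span_of A"
  have G: "add_subgroup G" and AG: "A \<subseteq> G"
    by (simp_all add: G_def add_subgroup_span_of span_of_superset)
  have SG: "S \<subseteq> G"
    using AG add_subgroup_zero[OF G] add_subgroup_uminus[OF G] by (auto simp: S_def)
  have sym: "- s \<in> S" if "s \<in> S" for s using that by (auto simp: S_def)
  have "G \<noteq> {0}" using AG ne admissible_zero[OF adm] by auto
  from subgroup_isoperimetry[OF G SG _ sym this] obtain K where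
    K: "add_subgroup K" "K \<subseteq> G" "K \<noteq> G" and expand: "\<And>X. X \<subseteq> G \<Longrightarrow> X \<noteq> {} \<Longrightarrow>
      min (card G) (card X + (card (K + S) - card K)) \<le> card (X + S)"
    by (auto simp: S_def)
  define g where "g = card (K + S) - card K"
  have KS: "K \<subseteq> K + S" by (rule set_plus_superset) (simp add: S_def)
  have g_eq: "g = card (K + S - K)" using KS by (simp add: g_def card_Diff_subset)
  have not_sub: "\<not> A \<subseteq> K" using span_of_least[OF K(1), of A] K by (auto simp: G_def)
  then obtain b where b: "b \<in> A" "b \<notin> K" by blast
  have "(\<lambda>x. x + b) ` K \<subseteq> K + S - K"
  proof
    fix y assume "y \<in> (\<lambda>x. x + b) ` K"
    then obtain x where x: "x \<in> K" "y = x + b" by blast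
    have "x + b \<in> K + S" using x b by (intro set_plus_intro) (simp_all add: S_def)
    moreover have "x + b \<notin> K" using b add_subgroup_diff[OF K(1) _ x(1), of "x + b"] by auto
    ultimately show "y \<in> K + S - K" using x by simp
  qed
  then have "card ((\<lambda>x. x + b) ` K) \<le> g" unfolding g_eq by (intro card_mono) auto
  then have gK: "card K \<le> g" by (simp add: card_image inj_on_def)
  have "(A - K) \<union> uminus ` (A - K) \<subseteq> K + S - K"
  proof -
    have "S \<subseteq> S + K" using add_subgroup_zero[OF K(1)] by (rule set_plus_superset)
    then have "S \<subseteq> K + S" by (simp only: add.commute)
    moreover have "- x \<notin> K" if "x \<notin> K" for x
      using add_subgroup_uminus[OF K(1), of "- x"] that by auto
    ultimately show ?thesis unfolding S_def by blast
  qed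
  then have "card ((A - K) \<union> uminus ` (A - K)) \<le> g" unfolding g_eq by (intro card_mono) auto
  then have gA: "2 * card (A - K) \<le> g" using card_symmetrize[OF adm, of "A - K"] by simp
  have "card ((A \<inter> K) \<union> uminus ` (A \<inter> K)) \<le> card K"
    using add_subgroup_uminus[OF K(1)] by (intro card_mono) auto
  then have KA: "2 * card (A \<inter> K) \<le> card K" using card_symmetrize[OF adm, of "A \<inter> K"] by simp
  define m where "m = Max (boundary (subset_sums A) ` A)"
  have "m \<in> boundary (subset_sums A) ` A" unfolding m_def using ne by (intro Max_in) auto
  then obtain a where a: "a \<in> A" "boundary (subset_sums A) a = m" by auto
  \<comment> \<open>The boundary vanishes at \<open>0\<close> and is even, so its maximum over
    \<open>A\<close> bounds it on all of \<open>S\<close>.\<close>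
  have bm: "boundary (subset_sums A) s \<le> m" if "s \<in> S" for s
    using that by (auto simp: S_def boundary_uminus m_def)
  have "card K > 0" using add_subgroup_zero[OF K(1)] by (auto simp: card_gt_0_iff)
  then have "g > 0" using gK by simp
  have "subset_sums A \<subseteq> G" "subset_sums A \<noteq> {}" "subset_sums A \<noteq> G"
    using subset_sums_le_span(1) zero_in_subset_sums subset_sums_ne_span[OF adm ne]
    by (auto simp: G_def)
  then have "g * d \<le> 2 * m * (d + g)"
    unfolding d_def defect_def G_def[symmetric]
    by (intro large_boundary[OF G SG \<open>g > 0\<close> _ bm] expand[folded g_def])
  also have "\<dots> \<le> 2 * (card (subset_sums A) - card (subset_sums (A - {a}))) * (d + g)"
    using boundary_le_growth[OF a(1)] a(2) by (intro mult_right_mono mult_left_mono) auto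
  finally show ?thesis by (rule that[OF a(1) K(1) not_sub gA gK KA])
qed

subsection \<open>The bound with constant 1/64\<close>

text \<open>The inequality reads \<open>(d - 2 * m) * g \<le> 2 * m * d\<close>. It is automatic if
  \<open>d \<le> 2 * m\<close>, and otherwise it survives decreasing \<open>g\<close>.\<close>

lemma gain_mono:
  fixes g g' d m :: real
  assumes "g * d \<le> 2 * m * (d + g)" "0 \<le> g'" "g' \<le> g" "0 \<le> m" "0 \<le> d"
  shows "g' * d \<le> 2 * m * (d + g')"
proof (cases "d \<le> 2 * m")
  case True
  then have "g' * d \<le> g' * (2 * m)" using assms by (intro mult_left_mono)
  also have "\<dots> \<le> 2 * m * (d + g')" using assms by (simp add: algebra_simps)
  finally show ?thesis .
next
  case False
  then have "(d - 2 * m) * g' \<le> (d - 2 * m) * g" using assms by (intro mult_left_mono) auto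
  then show ?thesis using assms(1) by (simp add: algebra_simps)
qed

text \<open>Either the span shrinks and the sums halve, or the span stays and the \<open>m\<close>
  lost sums join the defect. The two lower bounds on the expansion stay as alternatives, so that
  each induction can choose its own \<open>g\<close>.\<close>

lemma admissible_induct_step:
  fixes A :: "'a::{ab_group_add, finite} set"
  assumes adm: "admissible A" and ne: "A \<noteq> {}"
  defines "n \<equiv> card A"
  obtains a K where "a \<in> A" "add_subgroup K" "card (A \<inter> K) < n" "2 * card (A \<inter> K) \<le> card K"
    "card (subset_sums A) = 2 * card (subset_sums (A - {a})) \<or>
      (\<exists>m. m \<ge> 0 \<and>
        real (card (subset_sums A)) = real (card (subset_sums (A - {a}))) + m \<and>
        real (defect (A - {a})) = real (defect A) + m \<and>
        (\<forall>g. 0 \<le> g \<longrightarrow> (g \<le> 2 * (real n - real (card (A \<inter> K))) \<or> g \<le> real (card K)) \<longrightarrow>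
          g * min (real (card (subset_sums A))) (real (defect A)) \<le>
            2 * m * (min (real (card (subset_sums A))) (real (defect A)) + g)))"
proof -
  define d where "d = min (card (subset_sums A)) (defect A)"
  from admissible_step[OF adm ne, folded d_def] obtain a K g where
    a: "a \<in> A" and K: "add_subgroup K" "\<not> A \<subseteq> K" and gA: "2 * card (A - K) \<le> g"
    and gK: "card K \<le> g" and KA: "2 * card (A \<inter> K) \<le> card K"
    and gain: "g * d \<le> 2 * (card (subset_sums A) - card (subset_sums (A - {a}))) * (d + g)" .
  define m where "m = card (subset_sums A) - card (subset_sums (A - {a}))"
  have n_eq: "n = card (A \<inter> K) + card (A - K)"
    unfolding n_def by (subst card_Un_disjoint[symmetric]) (auto intro!: arg_cong[where f = card])
  have "card (A - K) > 0" using K by (auto simp: card_gt_0_iff)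
  then have x: "card (A \<inter> K) < n" using n_eq by simp
  have Bm: "card (subset_sums A) = card (subset_sums (A - {a})) + m"
    using boundary_le_growth[OF a] by (simp add: m_def)
  show ?thesis
  proof (cases "span_of (A - {a}) = span_of A")
    case True
    have "defect (A - {a}) = defect A + m"
      using subset_sums_le_span(2)[of A] subset_sums_le_span(2)[of "A - {a}"] Bm True by simp
    moreover have "h * real d \<le> 2 * real m * (real d + h)"
      if "0 \<le> h" "h \<le> 2 * (real n - real (card (A \<inter> K))) \<or> h \<le> real (card K)" for h
    proof (rule gain_mono)
      have "real (g * d) \<le> real (2 * m * (d + g))"
        using gain unfolding m_def of_nat_le_iff .
      then show "real g * real d \<le> 2 * real m * (real d + real g)" by simp
      show "h \<le> real g" using that(2) gA gK n_eq by auto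
    qed (use that in auto)
    ultimately show ?thesis
      using Bm by (intro that[OF a K(1) x KA] disjI2 exI[of _ "real m"]) (simp add: d_def of_nat_min)
  next
    case False
    show ?thesis
      by (rule that[OF a K(1) x KA disjI1[OF card_subset_sums_doubles[OF a False]]])
  qed
qed

section \<open>Estimates for the truncated logarithm\<close>

lemma log_potential_antimono:
  fixes c c' \<tau> \<tau>' :: real
  assumes "0 < c" "c \<le> c'" "0 \<le> \<tau>'" "\<tau>' \<le> \<tau>"
  shows "max 0 (ln (\<tau>' / c')) \<le> max 0 (ln (\<tau> / c))"
proof (cases "\<tau>' > 0")
  case True
  have "\<tau>' / c' \<le> \<tau> / c" using assms by (intro frac_le) auto
  moreover have "0 < \<tau>' / c'" using True assms by simp
  ultimately have "ln (\<tau>' / c') \<le> ln (\<tau> / c)" by (intro ln_mono) auto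
  then show ?thesis by simp
\<comment> \<open>Here \<open>\<tau>' = 0\<close>, and \<open>ln 0 = 0\<close> by
  convention.\<close>
qed (use assms in simp)

text \<open>The condition \<open>2 * c \<le> \<tau>\<close> keeps the logarithm nonnegative after
  \<open>c\<close> is multiplied by \<open>1 + \<beta>\<close>, so the truncation does not swallow
  the drop.\<close>

lemma log_potential_drop:
  fixes c c' \<tau> \<tau>' \<beta> :: real
  assumes "0 < c" "(1 + \<beta>) * c \<le> c'" "0 \<le> \<tau>'" "\<tau>' \<le> \<tau>" "2 * c \<le> \<tau>" "0 \<le> \<beta>" "\<beta> \<le> 1"
  shows "max 0 (ln (\<tau>' / c')) + ln (1 + \<beta>) \<le> max 0 (ln (\<tau> / c))"
proof -
  have "(1 + \<beta>) * c \<le> 2 * c" using assms by (intro mult_right_mono) auto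
  then have le: "(1 + \<beta>) * c \<le> \<tau>" using assms(5) by linarith
  have "max 0 (ln (\<tau>' / c')) \<le> max 0 (ln (\<tau> / ((1 + \<beta>) * c)))"
    using assms by (intro log_potential_antimono) auto
  also have "\<tau> / ((1 + \<beta>) * c) \<ge> 1" using le assms by simp
  then have "max 0 (ln (\<tau> / ((1 + \<beta>) * c))) = ln (\<tau> / ((1 + \<beta>) * c))" by simp
  also have "\<dots> = ln (\<tau> / c) - ln (1 + \<beta>)"
  proof -
    have "\<tau> / ((1 + \<beta>) * c) = (\<tau> / c) / (1 + \<beta>)" by simp
    moreover have "\<tau> / c > 0" "1 + \<beta> > 0" using assms by simp_all
    ultimately show ?thesis by (metis ln_divide_pos)
  qed
  finally show ?thesis by linarith
qed

lemma ln_23_16: "5 / 16 \<le> ln (1 + 7 / 16 :: real)"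
proof -
  have "exp (5 / 16 :: real) \<le> 1 + 5 / 16 + (5 / 16) ^ 2" by (rule exp_bound) auto
  also have "\<dots> \<le> 1 + 7 / 16" by (simp add: power2_eq_square)
  finally show ?thesis by (subst ln_ge_iff) auto
qed

text \<open>The tangent of \<open>ln\<close> at \<open>x = 32\<close>, with
  \<open>ln (64 / 7) \<le> 7 / 3\<close>. It bounds the potential when all that is known of the
  defect is that it is at least \<open>1\<close>.\<close>

lemma ln_tangent_32:
  fixes x :: real
  assumes "x \<ge> 32"
  shows "ln (2 * x / 7) \<le> x / 32 + 4 / 3"
proof -
  have "25 / 18 \<le> exp (1 / 3 :: real)"
    using exp_lower_Taylor_quadratic[of "1 / 3"] by (simp add: power2_eq_square)
  then have "(25 / 18) ^ 7 \<le> exp (1 / 3 :: real) ^ 7" by (intro power_mono) auto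
  moreover have "64 / 7 \<le> (25 / 18 :: real) ^ 7" by (simp add: power_divide)
  ultimately have "64 / 7 \<le> exp (7 / 3 :: real)" by (simp flip: exp_of_nat_mult)
  then have "ln (64 / 7) \<le> ln (exp (7 / 3 :: real))" by (intro ln_mono) auto
  then have "ln (64 / 7) \<le> (7 / 3 :: real)" by simp
  moreover have "ln (2 * x / 7) = ln (64 / 7) + ln (x / 32)"
    using assms ln_mult_pos[of "64 / 7" "x / 32"] by simp
  moreover have "ln (x / 32) \<le> x / 32 - 1" using assms by (intro ln_le_minus_one) auto
  ultimately show ?thesis by simp
qed

text \<open>
  The logarithmic term pays for the elements which are removed while \<open>subset_sums A\<close> nearly fills
  the group it spans: in that range the defect grows by a constant factor at each step.
\<close>

lemma card_subset_sums_potential: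
  fixes A :: "'a::{ab_group_add, finite} set"
  assumes "admissible A"
  shows "real (card (subset_sums A)) \<ge> real (card A) ^ 2 / 32 -
    real (card A) / 5 * max 0 (ln (2 * real (card A) / 7 / real (defect A)))"
  using assms
proof (induction "card A" arbitrary: A rule: less_induct)
  case less
  define n where "n = real (card A)"
  define c where "c = real (defect A)"
  define B where "B = real (card (subset_sums A))"
  have B_gt: "n + 1 \<le> B"
    using card_subset_sums_ge[OF less.prems] by (simp add: B_def n_def)
  show ?case
  proof (cases "card A \<le> 32")
    case True
    then have "n * n \<le> 32 * n" by (intro mult_right_mono) (auto simp: n_def)
    then have "n ^ 2 / 32 \<le> B" using B_gt by (simp add: power2_eq_square)
    moreover have "0 \<le> n / 5 * max 0 (ln (2 * n / 7 / c))" by (simp add: n_def)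
    ultimately show ?thesis unfolding n_def c_def B_def by linarith
  next
    case False
    then have n33: "n \<ge> 33" by (simp add: n_def)
    have ne: "A \<noteq> {}" using False by auto
    have c1: "c \<ge> 1" using defect_pos[OF less.prems ne] by (simp add: c_def)
    obtain a K where a: "a \<in> A" and K: "card (A \<inter> K) < card A" "2 * card (A \<inter> K) \<le> card K"
      and step: "card (subset_sums A) = 2 * card (subset_sums (A - {a})) \<or>
      (\<exists>m. m \<ge> 0 \<and>
        B = real (card (subset_sums (A - {a}))) + m \<and>
        real (defect (A - {a})) = c + m \<and>
        (\<forall>g. 0 \<le> g \<longrightarrow> (g \<le> 2 * (n - real (card (A \<inter> K))) \<or> g \<le> real (card K)) \<longrightarrow>
          g * min B c \<le> 2 * m * (min B c + g)))"
      using admissible_induct_step[OF less.prems ne] unfolding n_def c_def B_def by metis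
    define c' where "c' = real (defect (A - {a}))"
    define B' where "B' = real (card (subset_sums (A - {a})))"
    have cardA': "real (card (A - {a})) = n - 1" "card (A - {a}) < card A"
      using a False by (simp_all add: n_def)
    have adm': "admissible (A - {a})" using less.prems by (rule admissible_subset) auto
    have IH: "B' \<ge> (n - 1) ^ 2 / 32 - (n - 1) / 5 * max 0 (ln (2 * (n - 1) / 7 / c'))"
      using less.hyps[OF cardA'(2) adm'] unfolding cardA'(1) B'_def c'_def .
    have "n ^ 2 / 32 - n / 5 * max 0 (ln (2 * n / 7 / c)) \<le> B"
    proof (cases "card (subset_sums A) = 2 * card (subset_sums (A - {a}))")
      case True
      \<comment> \<open>The inductive bound counts twice here. From \<open>n = 33\<close> on, this
        outweighs even the largest possible logarithmic term.\<close>
      then have "B = 2 * B'" by (simp add: B_def B'_def)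
      have "card (A - {a}) \<noteq> 0" using cardA'(1) n33 by linarith
      then have "A - {a} \<noteq> {}" by (metis card.empty)
      then have c'1: "c' \<ge> 1" using defect_pos[OF adm'] by (simp add: c'_def)
      have "max 0 (ln (2 * (n - 1) / 7 / c')) \<le> max 0 (ln (2 * (n - 1) / 7 / 1))"
        using c'1 n33 by (intro log_potential_antimono) auto
      also have "\<dots> \<le> (n - 1) / 32 + 4 / 3"
        using ln_tangent_32[of "n - 1"] n33 by simp
      finally have "(n - 1) / 5 * max 0 (ln (2 * (n - 1) / 7 / c')) \<le>
          (n - 1) / 5 * ((n - 1) / 32 + 4 / 3)"
        using n33 by (intro mult_left_mono) auto
      from order_trans[OF diff_left_mono[OF this] IH]
      have "B \<ge> 2 * ((n - 1) ^ 2 / 32 - (n - 1) / 5 * ((n - 1) / 32 + 4 / 3))"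
        unfolding \<open>B = 2 * B'\<close> by (intro mult_left_mono) auto
      moreover have "n ^ 2 / 32 \<le> 2 * ((n - 1) ^ 2 / 32 - (n - 1) / 5 * ((n - 1) / 32 + 4 / 3))"
      proof -
        have "33 * (n - 33) \<le> n * (n - 33)" using n33 by (intro mult_right_mono) auto
        then show ?thesis using n33 by (simp add: power2_eq_square field_simps)
      qed
      moreover have "0 \<le> n / 5 * max 0 (ln (2 * n / 7 / c))" using n33 by simp
      ultimately show ?thesis by linarith
    next
      case False
      then obtain m where m: "m \<ge> 0" "B = B' + m" "c' = c + m" and
        gain: "\<And>g. 0 \<le> g \<Longrightarrow> g \<le> 2 * (n - real (card (A \<inter> K))) \<or> g \<le> real (card K) \<Longrightarrow>
          g * min B c \<le> 2 * m * (min B c + g)"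
        using step unfolding B'_def c'_def by blast
      have "real (2 * card (A \<inter> K)) \<le> real (card K)" using K(2) by (simp only: of_nat_le_iff)
      \<comment> \<open>The choice \<open>g = n\<close> is allowed: if \<open>A \<inter> K\<close>
        has at most \<open>n / 2\<close> elements the first alternative holds, and otherwise
        \<open>card K\<close> exceeds \<open>n\<close>.\<close>
      then have nm: "n * min B c \<le> 2 * m * (min B c + n)"
        using n33 by (intro gain) auto
      have sq: "(n - 1) ^ 2 = n ^ 2 - 2 * n + 1" by (simp add: power2_eq_square algebra_simps)
      show ?thesis
      proof (cases "c \<ge> n / 7")
        case True
        \<comment> \<open>With a large defect, the loss is at least \<open>n / 16\<close>, which
          covers the decrease \<open>(2 * n - 1) / 32\<close> of the main term.\<close>
        then have "min B c \<ge> n / 7" using B_gt n33 by simp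
        then have "min B c + n \<le> 8 * min B c" by linarith
        then have "2 * m * (min B c + n) \<le> 2 * m * (8 * min B c)"
          using m(1) by (intro mult_left_mono) auto
        with nm have "min B c * n \<le> min B c * (16 * m)" by (simp add: mult_ac)
        moreover have "min B c > 0" using c1 B_gt n33 by simp
        ultimately have m16: "n \<le> 16 * m" by simp
        have "(n - 1) / 5 * max 0 (ln (2 * (n - 1) / 7 / c')) \<le> n / 5 * max 0 (ln (2 * n / 7 / c))"
          using n33 c1 m by (intro mult_mono log_potential_antimono) auto
        moreover have "n ^ 2 / 32 \<le> (n - 1) ^ 2 / 32 + m"
          using m16 sq by linarith
        ultimately show ?thesis using IH m(2) by linarith
      next
        case False
        \<comment> \<open>With a small defect, the defect grows by the factor
          \<open>23 / 16\<close>, so the logarithm falls by at least \<open>5 / 16\<close>.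
          Multiplied by \<open>n / 5\<close>, this pays \<open>n / 16\<close>.\<close>
        then have d: "min B c = c" using B_gt n33 by simp
        have "n * c \<le> 2 * m * (c + n)" using nm d by simp
        also have "\<dots> \<le> 2 * m * (8 / 7 * n)"
          using m(1) False by (intro mult_left_mono) auto
        also have "\<dots> = n * (16 / 7 * m)" by simp
        finally have "n * c \<le> n * (16 / 7 * m)" .
        then have "c \<le> 16 / 7 * m" using n33 by simp
        then have c'c: "(1 + 7 / 16) * c \<le> c'" using m(3) by simp
        have "max 0 (ln (2 * (n - 1) / 7 / c')) + ln (1 + 7 / 16) \<le> max 0 (ln (2 * n / 7 / c))"
          using c1 c'c n33 False by (intro log_potential_drop) auto
        then have "max 0 (ln (2 * (n - 1) / 7 / c')) \<le> max 0 (ln (2 * n / 7 / c)) - 5 / 16"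
          using ln_23_16 by linarith
        then have "n / 5 * max 0 (ln (2 * (n - 1) / 7 / c')) \<le>
            n / 5 * (max 0 (ln (2 * n / 7 / c)) - 5 / 16)"
          using n33 by (intro mult_left_mono) auto
        moreover have "(n - 1) / 5 * max 0 (ln (2 * (n - 1) / 7 / c')) \<le>
            n / 5 * max 0 (ln (2 * (n - 1) / 7 / c'))"
          using n33 by (intro mult_right_mono) auto
        moreover have "n / 5 * (max 0 (ln (2 * n / 7 / c)) - 5 / 16) =
            n / 5 * max 0 (ln (2 * n / 7 / c)) - n / 16" by (simp add: right_diff_distrib)
        moreover have "n ^ 2 / 32 \<le> (n - 1) ^ 2 / 32 + n / 16" using sq by linarith
        ultimately show ?thesis using IH m(1,2) by linarith
      qed
    qed
    then show ?thesis unfolding n_def c_def B_def .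
  qed
qed

text \<open>Beyond 64 elements, the logarithmic term costs at most half of the main term
  \<open>n ^ 2 / 32\<close>; up to 64 elements, the linear bound suffices.\<close>

lemma card_subset_sums_weak:
  fixes A :: "'a::{ab_group_add, finite} set"
  assumes "admissible A"
  shows "real (card A) ^ 2 / 64 \<le> real (card (subset_sums A))"
proof -
  define n where "n = real (card A)"
  consider "n \<le> 64" | "n > 64" by linarith
  then show ?thesis
  proof cases
    case 1
    then have "n * n \<le> 64 * n" by (intro mult_right_mono) (auto simp: n_def)
    then show ?thesis using card_subset_sums_ge[OF assms]
      by (simp add: n_def power2_eq_square)
  next
    case 2
    then have "A \<noteq> {}" by (auto simp: n_def)
    then have c: "real (defect A) \<ge> 1" using defect_pos[OF assms] by simp
    have "max 0 (ln (2 * n / 7 / real (defect A))) \<le> max 0 (ln (2 * n / 7 / 1))"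
      using c 2 by (intro log_potential_antimono) auto
    also have "\<dots> \<le> n / 32 + 4 / 3" using ln_tangent_32[of n] 2 by simp
    finally have "n / 5 * max 0 (ln (2 * n / 7 / real (defect A))) \<le> n / 5 * (n / 32 + 4 / 3)"
      using 2 by (intro mult_left_mono) auto
    moreover have "64 * n \<le> n * n" using 2 by (intro mult_right_mono) auto
    moreover have "n / 5 * (n / 32 + 4 / 3) = n * n / 160 + n * (4 / 15)"
      by (simp add: field_simps)
    ultimately have "n / 5 * max 0 (ln (2 * n / 7 / real (defect A))) \<le> n * n / 64"
      using 2 by linarith
    moreover have "n * n / 64 = n ^ 2 / 32 - n * n / 64" by (simp add: power2_eq_square)
    ultimately show ?thesis using card_subset_sums_potential[OF assms]
      unfolding n_def[symmetric] power2_eq_square by linarith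
  qed
qed

subsection \<open>The asymptotic bound\<close>

text \<open>The same induction with a gain of \<open>(1 - 1 / T) * n\<close> at each step.
  \<open>N\<close> bounds the initial size and stays fixed. Below \<open>N / T\<close> elements the
  claim is trivial; \<open>L\<close> says that above this cutoff the weak bound dominates the
  accumulated logarithmic cost.\<close>

lemma card_subset_sums_potential_strong:
  fixes A :: "'a::{ab_group_add, finite} set" and T N :: real
  assumes adm: "admissible A" and AN: "real (card A) \<le> N"
    and T: "T \<ge> 1024" and NT3: "512 * T ^ 3 \<le> N"
    and L: "2 * N + 64 * T * N * ln (8 * T * N) \<le> (N / T) ^ 2 / 64"
  shows "real (card (subset_sums A)) \<ge> (1 / 2 - 1 / (2 * T)) * (real (card A) ^ 2 - (N / T) ^ 2) -
    32 * T * N * max 0 (ln (8 * T * real (card A) / real (defect A)))"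
  using adm AN
proof (induction "card A" arbitrary: A rule: less_induct)
  case less
  define \<alpha> where "\<alpha> = 1 / 2 - 1 / (2 * T)"
  define r where "r = N / T"
  define n where "n = real (card A)"
  define c where "c = real (defect A)"
  define B where "B = real (card (subset_sums A))"
  have \<alpha>: "0 \<le> \<alpha>" "\<alpha> \<le> 1 / 2" using T by (auto simp: \<alpha>_def field_simps)
  have N0: "N > 0" using NT3 T by (smt (verit) zero_less_power)
  have r0: "r > 0" using N0 T by (simp add: r_def)
  have r_ge: "512 * T ^ 2 \<le> r"
    using NT3 T by (simp add: r_def pos_le_divide_eq power2_eq_square power3_eq_cube mult.assoc)
  have nN: "n \<le> N" using less.prems by (simp add: n_def)
  have B_ge: "n ^ 2 / 64 \<le> B"
    using card_subset_sums_weak[OF less.prems(1)] by (simp add: B_def n_def)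
  show ?case
  proof (cases "n < r")
    case True
    then have "n ^ 2 \<le> r ^ 2" by (intro power_mono) (auto simp: n_def)
    then have "\<alpha> * (n ^ 2 - r ^ 2) \<le> 0" using \<alpha> by (simp add: mult_nonneg_nonpos)
    moreover have "0 \<le> 32 * T * N * max 0 (ln (8 * T * n / c))" using T N0 by simp
    moreover have "0 \<le> B" by (simp add: B_def)
    ultimately show ?thesis
      unfolding \<alpha>_def[symmetric] r_def[symmetric] n_def[symmetric] c_def[symmetric] B_def[symmetric]
      by linarith
  next
    case False
    then have nr: "n \<ge> r" by simp
    have n_big: "512 * T ^ 2 \<le> n" using nr r_ge by simp
    have T2: "1024 * T \<le> T ^ 2" using T by (simp add: power2_eq_square)
    have n1: "n \<ge> 1" using n_big T2 T by linarith
    then have ne: "A \<noteq> {}" by (auto simp: n_def)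
    have c1: "c \<ge> 1" using defect_pos[OF less.prems(1) ne] by (simp add: c_def)
    have B_big: "4 * T * n \<le> B"
    proof -
      have "256 * T * n \<le> n * n" using n_big T2 T n1 by (intro mult_right_mono) auto
      then show ?thesis using B_ge by (simp add: power2_eq_square)
    qed
    obtain a K where a: "a \<in> A" and K: "add_subgroup K" "card (A \<inter> K) < card A"
      and step: "card (subset_sums A) = 2 * card (subset_sums (A - {a})) \<or>
      (\<exists>m. m \<ge> 0 \<and>
        B = real (card (subset_sums (A - {a}))) + m \<and>
        real (defect (A - {a})) = c + m \<and>
        (\<forall>g. 0 \<le> g \<longrightarrow> (g \<le> 2 * (n - real (card (A \<inter> K))) \<or> g \<le> real (card K)) \<longrightarrow>
          g * min B c \<le> 2 * m * (min B c + g)))"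
      using admissible_induct_step[OF less.prems(1) ne] unfolding n_def c_def B_def by metis
    define c' where "c' = real (defect (A - {a}))"
    define B' where "B' = real (card (subset_sums (A - {a})))"
    have cardA': "real (card (A - {a})) = n - 1" "card (A - {a}) < card A"
    proof -
      show "card (A - {a}) < card A" using a by (intro psubset_card_mono) auto
      show "real (card (A - {a})) = n - 1" using a n1 by (simp add: n_def of_nat_diff)
    qed
    have adm': "admissible (A - {a})" using less.prems(1) by (rule admissible_subset) auto
    have "real (card (A - {a})) \<le> N" using cardA'(1) nN by linarith
    from less.hyps[OF cardA'(2) adm' this]
    have IH: "B' \<ge> \<alpha> * ((n - 1) ^ 2 - r ^ 2) - 32 * T * N * max 0 (ln (8 * T * (n - 1) / c'))"
      unfolding cardA'(1) B'_def c'_def \<alpha>_def r_def .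
    have drop: "\<alpha> * (n ^ 2 - r ^ 2) - (1 - 1 / T) * n \<le> \<alpha> * ((n - 1) ^ 2 - r ^ 2)"
    proof -
      have "\<alpha> * ((n - 1) ^ 2 - r ^ 2) = \<alpha> * (n ^ 2 - r ^ 2) - 2 * \<alpha> * n + \<alpha>"
        by (simp add: power2_eq_square algebra_simps)
      moreover have "2 * \<alpha> = 1 - 1 / T" by (simp add: \<alpha>_def)
      ultimately show ?thesis using \<alpha> by simp
    qed
    have n_drop: "(1 - 1 / T) * n \<le> N"
    proof -
      have "(1 - 1 / T) * n \<le> 1 * n" using T n1 by (intro mult_right_mono) auto
      then show ?thesis using nN by simp
    qed
    have "\<alpha> * (n ^ 2 - r ^ 2) - 32 * T * N * max 0 (ln (8 * T * n / c)) \<le> B"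
    proof (cases "card (subset_sums A) = 2 * card (subset_sums (A - {a}))")
      case True
      then have BB: "B = 2 * B'" by (simp add: B_def B'_def)
      have "card (A - {a}) \<noteq> 0" using cardA'(1) n_big T2 T by linarith
      then have "A - {a} \<noteq> {}" by (metis card.empty)
      then have c'1: "c' \<ge> 1" using defect_pos[OF adm'] by (simp add: c'_def)
      have "1 * 1 \<le> 8 * T * N" using T nN n1 by (intro mult_mono) auto
      then have L0: "0 \<le> ln (8 * T * N)" by (intro ln_ge_zero) auto
      have "max 0 (ln (8 * T * (n - 1) / c')) \<le> max 0 (ln (8 * T * N / 1))"
        using c'1 n1 T nN by (intro log_potential_antimono) auto
      then have "max 0 (ln (8 * T * (n - 1) / c')) \<le> ln (8 * T * N)" using L0 by simp
      then have "32 * T * N * max 0 (ln (8 * T * (n - 1) / c')) \<le> 32 * T * N * ln (8 * T * N)"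
        using T N0 by (intro mult_left_mono) auto
      then have ge: "B \<ge> 2 * (\<alpha> * (n ^ 2 - r ^ 2)) - 2 * N - 64 * T * N * ln (8 * T * N)"
        using IH drop n_drop BB by linarith
      have "\<alpha> * (n ^ 2 - r ^ 2) \<le> B"
      \<comment> \<open>If the main term exceeds the error in \<open>ge\<close>, doubling it absorbs
        that error; if not, \<open>L\<close> and \<open>n \<ge> r\<close> put it below the weak
        bound \<open>n ^ 2 / 64\<close>.\<close>
      proof (cases "\<alpha> * (n ^ 2 - r ^ 2) \<ge> 2 * N + 64 * T * N * ln (8 * T * N)")
        case True
        then show ?thesis using ge by linarith
      next
        case False
        have "r ^ 2 \<le> n ^ 2" using nr r0 by (intro power_mono) auto
        then show ?thesis using False L B_ge unfolding r_def[symmetric] by linarith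
      qed
      moreover have "0 \<le> 32 * T * N * max 0 (ln (8 * T * n / c))" using T N0 by simp
      ultimately show ?thesis by linarith
    next
      case False
      then obtain m where m: "m \<ge> 0" "B = B' + m" "c' = c + m" and
        gain: "\<And>g. 0 \<le> g \<Longrightarrow> g \<le> 2 * (n - real (card (A \<inter> K))) \<or> g \<le> real (card K) \<Longrightarrow>
          g * min B c \<le> 2 * m * (min B c + g)"
        using step unfolding B'_def c'_def by blast
      define \<theta> where "\<theta> = 1 - 1 / (2 * T)"
      have \<theta>: "1 / 2 \<le> \<theta>" "\<theta> \<le> 1" using T by (auto simp: \<theta>_def field_simps)
      define x where "x = real (card (A \<inter> K))"
      \<comment> \<open>If \<open>K\<close> contains more than the fraction
        \<open>1 / (2 * T)\<close> of \<open>A\<close>, the weak bound for the admissible set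
        \<open>A \<inter> K\<close> forces \<open>card K \<ge> 2 * n\<close>. This is where
        \<open>n \<ge> 512 * T ^ 2\<close> enters.\<close>
      have "2 * \<theta> * n \<le> 2 * (n - x) \<or> 2 * \<theta> * n \<le> real (card K)"
      proof (cases "x \<le> n / (2 * T)")
        case True
        then show ?thesis by (simp add: \<theta>_def algebra_simps)
      next
        case False
        have "admissible (A \<inter> K)" using less.prems(1) by (rule admissible_subset) auto
        then have "x ^ 2 / 64 \<le> real (card (subset_sums (A \<inter> K)))"
          unfolding x_def by (rule card_subset_sums_weak)
        also have "\<dots> \<le> real (card K)"
          using subset_sums_subset[OF K(1), of "A \<inter> K"] by (simp add: card_mono)
        finally have "x ^ 2 / 64 \<le> real (card K)" .
        moreover have "(n / (2 * T)) ^ 2 \<le> x ^ 2"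
          using False T n1 by (intro power_mono) auto
        moreover have "2 * n \<le> (n / (2 * T)) ^ 2 / 64"
        proof -
          have "512 * T ^ 2 * n \<le> n * n" using n_big n1 by (intro mult_right_mono) auto
          then show ?thesis using T by (simp add: power2_eq_square field_simps)
        qed
        moreover have "2 * \<theta> * n \<le> 2 * n" using \<theta> n1 by simp
        ultimately show ?thesis by linarith
      qed
      then have "2 * \<theta> * n * min B c \<le> 2 * m * (min B c + 2 * \<theta> * n)"
        unfolding x_def using \<theta> n1 by (intro gain) auto
      also have "\<dots> \<le> 2 * m * (min B c + 2 * n)"
        using m(1) \<theta> n1 by (intro mult_left_mono add_left_mono) auto
      finally have g: "\<theta> * n * min B c \<le> m * (min B c + 2 * n)" by simp
      show ?thesis
      proof (cases "c \<ge> 4 * T * n")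
        case True
        then have d: "min B c \<ge> 4 * T * n" using B_big by simp
        then have d0: "min B c > 0" using T n1 by (smt (verit) mult_pos_pos)
        \<comment> \<open>Replacing \<open>min B c + 2 * n\<close> by \<open>min B c\<close> costs
          only the factor \<open>1 + 1 / (2 * T)\<close>, so the loss is at least
          \<open>(1 - 1 / T) * n\<close>.\<close>
        have "m * (2 * T * (min B c + 2 * n)) \<le> m * ((2 * T + 1) * min B c)"
          using d m(1) by (intro mult_left_mono) (auto simp: algebra_simps)
        moreover have "2 * T * (\<theta> * n * min B c) \<le> 2 * T * (m * (min B c + 2 * n))"
          using g T by (intro mult_left_mono) auto
        ultimately have "min B c * (2 * T * \<theta> * n) \<le> min B c * (m * (2 * T + 1))"
          by (simp add: mult_ac)
        then have 1: "2 * T * \<theta> * n \<le> m * (2 * T + 1)" using d0 by simp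
        have "(1 - 1 / T) * (2 * T + 1) \<le> 2 * T * \<theta>" using T by (simp add: \<theta>_def field_simps)
        then have "(1 - 1 / T) * (2 * T + 1) * n \<le> 2 * T * \<theta> * n"
          using n1 by (intro mult_right_mono) auto
        with 1 have "(2 * T + 1) * ((1 - 1 / T) * n) \<le> (2 * T + 1) * m" by (simp add: mult_ac)
        then have "(1 - 1 / T) * n \<le> m" using T by (subst (asm) mult_le_cancel_left_pos) auto
        moreover have "32 * T * N * max 0 (ln (8 * T * (n - 1) / c')) \<le>
            32 * T * N * max 0 (ln (8 * T * n / c))"
          using n1 c1 m T N0 by (intro mult_left_mono log_potential_antimono) auto
        ultimately show ?thesis using IH m(2) drop by linarith
      next
        case False
        then have d: "min B c = c" using B_big by simp
        \<comment> \<open>Now the defect grows by the factor \<open>1 + 1 / (16 * T)\<close>. The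
          logarithm falls by at least \<open>1 / (32 * T)\<close>, and its weight
          \<open>32 * T * N\<close> turns this into \<open>N\<close>, enough for one step.\<close>
        have "c + 2 * n \<le> (4 * T + 2) * n" using False by (simp add: algebra_simps)
        also have "\<dots> \<le> 8 * T * n" using T n1 by (intro mult_right_mono) auto
        finally have "m * (c + 2 * n) \<le> m * (8 * T * n)" using m(1) by (intro mult_left_mono) auto
        moreover have "1 / 2 * n * c \<le> \<theta> * n * c" using \<theta> n1 c1 by (intro mult_right_mono) auto
        ultimately have "n * c \<le> n * (16 * T * m)" using g d by (simp add: mult_ac)
        then have "c \<le> 16 * T * m" using n1 by simp
        then have "1 / (16 * T) * c \<le> m" using T by (simp add: field_simps)
        then have c'c: "(1 + 1 / (16 * T)) * c \<le> c'" using m(3) by (simp add: algebra_simps)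
        have "max 0 (ln (8 * T * (n - 1) / c')) + ln (1 + 1 / (16 * T)) \<le>
            max 0 (ln (8 * T * n / c))"
          using c1 c'c n1 T False by (intro log_potential_drop) auto
        moreover have "1 / (32 * T) \<le> ln (1 + 1 / (16 * T))"
        proof -
          have "1 / (16 * T) - (1 / (16 * T)) ^ 2 \<le> ln (1 + 1 / (16 * T))"
            using T by (intro ln_one_plus_pos_lower_bound) auto
          moreover have "1 / (32 * T) \<le> 1 / (16 * T) - (1 / (16 * T)) ^ 2"
            using T by (simp add: power2_eq_square field_simps)
          ultimately show ?thesis by linarith
        qed
        ultimately have "max 0 (ln (8 * T * (n - 1) / c')) \<le>
            max 0 (ln (8 * T * n / c)) - 1 / (32 * T)" by linarith
        then have "32 * T * N * max 0 (ln (8 * T * (n - 1) / c')) \<le>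
            32 * T * N * (max 0 (ln (8 * T * n / c)) - 1 / (32 * T))"
          using T N0 by (intro mult_left_mono) auto
        also have "\<dots> = 32 * T * N * max 0 (ln (8 * T * n / c)) - N"
          using T by (simp add: right_diff_distrib)
        finally show ?thesis using IH m(1,2) drop n_drop by linarith
      qed
    qed
    then show ?thesis unfolding \<alpha>_def r_def n_def c_def B_def .
  qed
qed

text \<open>Take \<open>N = card A\<close>. Since \<open>sqrt N\<close> is at least
  \<open>T ^ 5\<close>, the crude bound \<open>ln (8 * T * N) \<le> 4 * sqrt N\<close> already makes
  the logarithmic cost at most \<open>N ^ 2 / T\<close>. The total relative error stays below
  \<open>2 / T\<close>.\<close>

lemma card_subset_sums_strong:
  fixes A :: "'a::{ab_group_add, finite} set" and T :: real
  assumes adm: "admissible A" and T: "T \<ge> 1024" and N: "T ^ 10 \<le> real (card A)"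
  shows "real (card (subset_sums A)) \<ge> (1 / 2 - 2 / T) * real (card A) ^ 2"
proof -
  define N where "N = real (card A)"
  define s where "s = sqrt N"
  have "1 ^ 10 \<le> T ^ 10" using T by (intro power_mono) auto
  from order_trans[OF this N] have N1: "N \<ge> 1" unfolding N_def by simp
  have s2: "N = s * s" using N1 by (simp add: s_def)
  have s0: "s > 0" using N1 by (simp add: s_def)
  have "(T ^ 5) ^ 2 \<le> N" using N by (simp add: N_def flip: power_mult)
  then have sT: "T ^ 5 \<le> s" unfolding s_def by (rule real_le_rsqrt)
  have pow: "1048576 * T ^ 3 \<le> s"
  proof -
    have "1024 ^ 2 \<le> T ^ 2" using T by (intro power_mono) auto
    then have "1024 ^ 2 * T ^ 3 \<le> T ^ 2 * T ^ 3" using T by (intro mult_right_mono) auto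
    also have "\<dots> = T ^ 5" by (simp flip: power_add)
    finally show ?thesis using sT by simp
  qed
  have T3: "1024 * (1024 * T) \<le> T ^ 3" "1024 * T ^ 2 \<le> T ^ 3"
  proof -
    have "1024 * 1024 \<le> T * T" using T by (intro mult_mono) auto
    then have "1024 * 1024 * T \<le> T * T * T" using T by (intro mult_right_mono) auto
    then show "1024 * (1024 * T) \<le> T ^ 3" by (simp add: power3_eq_cube)
    have "1024 * (T * T) \<le> T * (T * T)" using T by (intro mult_right_mono) auto
    then show "1024 * T ^ 2 \<le> T ^ 3" by (simp add: power3_eq_cube power2_eq_square mult.assoc)
  qed
  have T_ge: "T > 0" using T by simp
  have s_ge: "s \<ge> 1" using pow T3 T by linarith
  have sN: "s \<le> N" using s_ge s0 by (simp add: s2)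
  have ln_le: "ln (8 * T * N) \<le> 4 * s"
  proof -
    have "8 * T \<le> s" using pow T3 T by linarith
    then have "8 * T * N \<le> s * (s * s)" unfolding s2 using s0 by (intro mult_right_mono) auto
    also have "\<dots> = s ^ 3" by (simp add: power3_eq_cube)
    finally have "ln (8 * T * N) \<le> ln (s ^ 3)" using T_ge N1 by (intro ln_mono) auto
    also have "\<dots> = 3 * ln s" using s0 by (simp add: ln_realpow)
    also have "\<dots> \<le> 4 * s" using ln_le_minus_one[OF s0] s0 by linarith
    finally show ?thesis .
  qed
  have tNl: "T * N * ln (8 * T * N) \<le> T * N * (4 * s)"
    using ln_le T_ge N1 by (intro mult_left_mono) auto
  have L: "2 * N + 64 * T * N * ln (8 * T * N) \<le> (N / T) ^ 2 / 64"
  proof -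
    have Ts: "T * N * s \<ge> N"
    proof -
      have "1 * 1 \<le> T * s" using T s_ge by (intro mult_mono) auto
      then have "1 * N \<le> T * s * N" using N1 by (intro mult_right_mono) auto
      then show ?thesis by (simp add: mult_ac)
    qed
    have "1048576 * T ^ 3 * (s * N) \<le> s * (s * N)"
      using pow s0 N1 by (intro mult_right_mono) auto
    then have "1048576 * (T * N * s) * T ^ 2 \<le> N ^ 2"
      unfolding s2 by (simp add: power2_eq_square power3_eq_cube mult_ac)
    then have "1048576 * (T * N * s) \<le> (N / T) ^ 2"
      using T_ge by (simp add: power_divide pos_le_divide_eq)
    moreover have "0 \<le> T * N * s" using T_ge N1 s0 by simp
    ultimately show ?thesis using tNl Ts by linarith
  qed
  have "512 * T ^ 3 \<le> N" using pow sN T_ge zero_less_power[OF T_ge, of 3] by linarith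
  from card_subset_sums_potential_strong[OF adm _ T this L]
  have main: "real (card (subset_sums A)) \<ge> (1 / 2 - 1 / (2 * T)) * (N ^ 2 - (N / T) ^ 2) -
    32 * T * N * max 0 (ln (8 * T * N / real (defect A)))"
    by (simp add: N_def)
  have "A \<noteq> {}" using N1 by (auto simp: N_def)
  then have c: "real (defect A) \<ge> 1" using defect_pos[OF adm] by simp
  have "max 0 (ln (8 * T * N / real (defect A))) \<le> max 0 (ln (8 * T * N / 1))"
    using c T_ge N1 by (intro log_potential_antimono) auto
  also have "\<dots> \<le> 4 * s" using ln_le s0 by simp
  finally have "32 * T * N * max 0 (ln (8 * T * N / real (defect A))) \<le> 32 * T * N * (4 * s)"
    using T_ge N1 by (intro mult_left_mono) auto
  also have "\<dots> \<le> N ^ 2 / T"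
  proof -
    have "128 * T ^ 2 \<le> s" using pow T3 zero_less_power[OF T_ge, of 2] by linarith
    then have "128 * T ^ 2 * (s * N) \<le> s * (s * N)" using s0 N1 by (intro mult_right_mono) auto
    then have "32 * T * N * (4 * s) * T \<le> N ^ 2"
      unfolding s2 by (simp add: power2_eq_square mult_ac)
    then show ?thesis using T_ge by (simp add: pos_le_divide_eq)
  qed
  finally have "32 * T * N * max 0 (ln (8 * T * N / real (defect A))) \<le> N ^ 2 / T" .
  from order_trans[OF diff_left_mono[OF this] main]
  have "(1 / 2 - 1 / (2 * T)) * (N ^ 2 - (N / T) ^ 2) - N ^ 2 / T \<le>
      real (card (subset_sums A))" .
  moreover have "(1 / 2 - 2 / T) * N ^ 2 \<le>
      (1 / 2 - 1 / (2 * T)) * (N ^ 2 - (N / T) ^ 2) - N ^ 2 / T"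
  proof -
    have "1 / 2 - 2 / T \<le> (1 / 2 - 1 / (2 * T)) * (1 - (1 / T) ^ 2) - 1 / T"
    proof -
      define u where "u = 1 / T"
      have u: "0 < u" "u \<le> 1" using T by (simp_all add: u_def)
      have "0 \<le> u * u * u" "u * u \<le> u * 1" using u by (simp, intro mult_left_mono) auto
      moreover have "(1 / 2 - u / 2) * (1 - u ^ 2) - u = 1 / 2 - 3 / 2 * u - u * u / 2 + u * u * u / 2"
        by (simp add: power2_eq_square field_simps)
      ultimately have "1 / 2 - 2 * u \<le> (1 / 2 - u / 2) * (1 - u ^ 2) - u" by linarith
      then show ?thesis by (simp add: u_def mult.commute)
    qed
    then have "(1 / 2 - 2 / T) * N ^ 2 \<le> ((1 / 2 - 1 / (2 * T)) * (1 - (1 / T) ^ 2) - 1 / T) * N ^ 2"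
      by (intro mult_right_mono) auto
    also have "\<dots> = (1 / 2 - 1 / (2 * T)) * (N ^ 2 - (N / T) ^ 2) - N ^ 2 / T"
      by (simp add: power_divide algebra_simps)
    finally show ?thesis .
  qed
  ultimately show ?thesis by (simp add: N_def)
qed

theorem theorem1p6:
  fixes A :: "'a::{ab_group_add, finite} set" and k :: nat
  assumes "A \<subseteq> UNIV - {0}"
    and "k \<ge> 9"
    and "A \<inter> uminus ` A = {}"
    and "stab (subset_sums A) = {0}"
    and "card A \<ge> n_seq k"
  shows "real (card (subset_sums A)) \<ge> alpha_seq k * real (card A) ^ 2"
proof -
  have adm: "admissible A" using assms by (simp add: admissible_def)
  show ?thesis
  proof (cases "k = 9")
    case True
    then show ?thesis using card_subset_sums_weak[OF adm] by (simp add: alpha_seq.simps)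
  next
    case False
    then have k: "k \<ge> 10" using assms(2) by simp
    \<comment> \<open>Apply the strong bound with \<open>T = 2 ^ k\<close>: then
      \<open>2 / T\<close> is \<open>1 / 2 ^ (k - 1)\<close>, and
      \<open>T ^ 10 \<le> 2 ^ (k ^ 2)\<close> because \<open>k \<ge> 10\<close>.\<close>
    have "(2::real) ^ 10 \<le> 2 ^ k" using k by (intro power_increasing) auto
    then have T: "(1024::real) \<le> 2 ^ k" by simp
    have "(2 ^ k :: nat) ^ 10 = 2 ^ (k * 10)" by (simp flip: power_mult)
    also have "\<dots> \<le> 2 ^ (k ^ 2)"
      using k by (intro power_increasing) (auto simp: power2_eq_square)
    also have "\<dots> \<le> card A" using assms(5) k by (simp add: n_seq_def)
    finally have "real ((2 ^ k) ^ 10) \<le> real (card A)" by (simp only: of_nat_le_iff)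
    then have N: "(2 ^ k :: real) ^ 10 \<le> real (card A)" by simp
    have "alpha_seq k \<le> 1 / 2 - 1 / 2 ^ (k - 1)"
      using k by (subst alpha_seq.simps) simp
    also have "1 / 2 ^ (k - 1) = 2 / (2 ^ k :: real)"
      using k by (cases k) auto
    finally have "alpha_seq k * real (card A) ^ 2 \<le> (1 / 2 - 2 / 2 ^ k) * real (card A) ^ 2"
      by (intro mult_right_mono) auto
    also have "\<dots> \<le> real (card (subset_sums A))" by (rule card_subset_sums_strong[OF adm T N])
    finally show ?thesis .
  qed
qed

end
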